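(* Suppose the integer program $\min\{c^{\top}x : Ax\le b,\ x\in\mathcal{X}\}$ is feasible and its optimal value is bounded. If a minimum achievable non-zero slack exists, i.e., there is a $\delta$ such that for every $i\in\{1,\dots,m\}$, $$0<\delta\le \min_{x\in\mathcal{X}}\{(a_i x-b_i)^2 : a_i x>b_i\},$$ then there exists a finite $\rho^*\in(0,+\infty)$ such that $$f^{\mathrm{LD}}_{\rho^*}=\min_{Ax\le b,\ x\in\mathcal{X}} c^{\top}x .$$
   Context: Problem data: $n=\sum_{j=1}^p n_j$, $p\ge1$, $c\in\mathbb{R}^n$, $A\in\mathbb{R}^{m\times n}$ with $i$-th row $a_i$, $b\in\mathbb{R}^m$ with $i$-th entry $b_i$. The vector $x=(x_1;\dots;x_p)$ has blocks $x_j\in\mathbb{R}^{n_j}$, and $\mathcal{X}=\mathcal{X}_1\times\dots\times\mathcal{X}_p$, where $\mathcal{X}_j=\{x_j\in\{0,1\}^{n_j}: B_jx_j\le d_j\}$ for given real matrices $B_j$ and vectors $d_j$. The set $\mathcal{X}$ is assumed nonempty. For $\lambda\in\mathbb{R}^m_+$ and $\rho>0$ the augmented Lagrangian is $$L(x,\lambda,\rho)=c^{\top}x+\lambda^{\top}(Ax-b)+\frac{\rho}{2}\|(Ax-b)_+\|^2,$$ where $(\cdot)_+$ is the componentwise positive part and $\|\cdot\|$ is the Euclidean norm. The augmented Lagrangian relaxation is $d(\lambda,\rho)=\min_{x\in\mathcal{X}}L(x,\lambda,\rho)$, and the augmented Lagrangian dual value is $f^{\mathrm{LD}}_\rho=\max_{\lambda\in\mathbb{R}^m_+}d(\lambda,\rho)$.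 A minimum over an empty set is $+\infty$. *)

theory Defs
  imports
    "HOL-Analysis.L2_Norm"
    "HOL-Library.Extended_Real"
    "Jordan_Normal_Form.Matrix"
begin

(* Blocks and coordinates are numbered from 0: x_j (j < p) occupies the nn j coordinates of x
   following those of the blocks 0, ..., j - 1. *)
definition block :: "(nat \<Rightarrow> nat) \<Rightarrow> nat \<Rightarrow> real vec \<Rightarrow> real vec" where
  "block nn j x = vec (nn j) (\<lambda>i. x $ ((\<Sum>k<j. nn k) + i))"

definition binary_polyhedral_set :: "nat \<Rightarrow> real mat \<Rightarrow> real vec \<Rightarrow> real vec set" where
  "binary_polyhedral_set k B d = {y \<in> carrier_vec k. (\<forall>i<k. y $ i \<in> {0, 1}) \<and> B *\<^sub>v y \<le> d}"

definition block_product_set ::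
  "nat \<Rightarrow> (nat \<Rightarrow> nat) \<Rightarrow> (nat \<Rightarrow> real mat) \<Rightarrow> (nat \<Rightarrow> real vec) \<Rightarrow> real vec set" where
  "block_product_set p nn B d =
     {x \<in> carrier_vec (\<Sum>j<p. nn j). \<forall>j<p. block nn j x \<in> binary_polyhedral_set (nn j) (B j) (d j)}"

definition pos_part :: "real vec \<Rightarrow> real vec" where
  "pos_part v = map_vec (\<lambda>t. max t 0) v"

definition eucl_norm :: "real vec \<Rightarrow> real" where
  "eucl_norm v = L2_set (\<lambda>i. v $ i) {..<dim_vec v}"

definition nonneg_vecs :: "nat \<Rightarrow> real vec set" where
  "nonneg_vecs m = {l \<in> carrier_vec m. 0\<^sub>v m \<le> l}"

definition aug_lagrangian ::
  "real vec \<Rightarrow> real mat \<Rightarrow> real vec \<Rightarrow> real vec \<Rightarrow> real vec \<Rightarrow> real \<Rightarrow> real" where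
  "aug_lagrangian c A b x l \<rho> =
     c \<bullet> x + l \<bullet> (A *\<^sub>v x - b) + \<rho> / 2 * (eucl_norm (pos_part (A *\<^sub>v x - b)))\<^sup>2"

(* Optimal values are extended reals, so that a minimum over the empty set is \<infinity>.  In the
   minima below X is a block_product_set, which is finite (finite_block_product_set), so every
   INF over a nonempty set is attained.  The SUP in alm_dual_value carries no such guarantee. *)
definition ip_feasible_set :: "real vec set \<Rightarrow> real mat \<Rightarrow> real vec \<Rightarrow> real vec set" where
  "ip_feasible_set X A b = {x \<in> X. A *\<^sub>v x \<le> b}"

definition ip_value :: "real vec set \<Rightarrow> real vec \<Rightarrow> real mat \<Rightarrow> real vec \<Rightarrow> ereal" where
  "ip_value X c A b = (INF x\<in>ip_feasible_set X A b. ereal (c \<bullet> x))"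

definition alm_relaxation ::
  "real vec set \<Rightarrow> real vec \<Rightarrow> real mat \<Rightarrow> real vec \<Rightarrow> real vec \<Rightarrow> real \<Rightarrow> ereal" where
  "alm_relaxation X c A b l \<rho> = (INF x\<in>X. ereal (aug_lagrangian c A b x l \<rho>))"

definition alm_dual_value ::
  "real vec set \<Rightarrow> real vec \<Rightarrow> real mat \<Rightarrow> real vec \<Rightarrow> real \<Rightarrow> ereal" where
  "alm_dual_value X c A b \<rho> = (SUP l\<in>nonneg_vecs (dim_vec b). alm_relaxation X c A b l \<rho>)"

definition min_sq_slack :: "real vec set \<Rightarrow> real mat \<Rightarrow> real vec \<Rightarrow> nat \<Rightarrow> ereal" where
  "min_sq_slack X A b i =
     (INF x\<in>{x \<in> X. row A i \<bullet> x > b $ i}. ereal ((row A i \<bullet> x - b $ i)\<^sup>2))"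

lemma finite_block_product_set: "finite (block_product_set p nn B d)"
proof -
  let ?n = "\<Sum>j<p. nn j"
  have split: "\<exists>j<q. \<exists>i<nn j. k = (\<Sum>r<j. nn r) + i" if "k < (\<Sum>j<q. nn j)" for k q
    using that
  proof (induction q)
    case (Suc q)
    show ?case
    proof (cases "k < (\<Sum>j<q. nn j)")
      case True
      then show ?thesis using Suc.IH less_SucI by blast
    next
      case False
      then have "k - (\<Sum>j<q. nn j) < nn q" "k = (\<Sum>j<q. nn j) + (k - (\<Sum>j<q. nn j))"
        using Suc.prems by auto
      then show ?thesis by blast
    qed
  qed simp
  have bin: "x $ k \<in> {0, 1}" if x: "x \<in> block_product_set p nn B d" and k: "k < ?n" for x k
  proof -
    obtain j i where "j < p" "i < nn j" "k = (\<Sum>r<j. nn r) + i"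
      using split[OF k] by blast
    with x show ?thesis
      by (auto simp: block_product_set_def binary_polyhedral_set_def block_def)
  qed
  have "block_product_set p nn B d \<subseteq> vec ?n ` ({..<?n} \<rightarrow>\<^sub>E {0, 1})"
  proof
    fix x assume x: "x \<in> block_product_set p nn B d"
    then have "dim_vec x = ?n" by (auto simp: block_product_set_def)
    then have "x = vec ?n (restrict (($) x) {..<?n})" by (intro eq_vecI) auto
    moreover have "restrict (($) x) {..<?n} \<in> {..<?n} \<rightarrow>\<^sub>E {0, 1}"
      using bin[OF x] by (intro restrict_PiE_iff[THEN iffD2]) blast
    ultimately show "x \<in> vec ?n ` ({..<?n} \<rightarrow>\<^sub>E {0, 1})" by blast
  qed
  then show ?thesis
    by (rule finite_subset) (intro finite_imageI finite_PiE, auto)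
qed

end

theory Submission
  imports Defs
begin

text \<open>
  The multiplier \<open>0\<close> already closes the duality gap.  On feasible points the penalty
  vanishes and \<open>l \<bullet> (A x - b) \<le> 0\<close>, so the dual value never exceeds the optimal value
  (\<open>alm_dual_value_le_ip_value\<close>).  Conversely, an infeasible point of \<open>X\<close> violates some
  row, and by the slack hypothesis that row alone contributes at least \<open>\<delta>\<close> to the squared
  norm (\<open>penalty_ge_slack\<close>).  Since \<open>X\<close> is finite, the objective has absolute value at most
  some \<open>M\<close> on it; once \<open>\<rho> / 2 * \<delta> \<ge> 2 * M\<close>, leaving the feasible region costs more than
  the objective can gain, so the relaxation at the multiplier \<open>0\<close> is at least the
  optimal value (\<open>ip_value_le_alm_relaxation_zero\<close>).
\<close>

lemma pos_part_eq_zero: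
  assumes "v \<in> carrier_vec m" "v \<le> 0\<^sub>v m"
  shows "pos_part v = 0\<^sub>v m"
proof (rule eq_vecI)
  fix i assume "i < dim_vec (0\<^sub>v m :: real vec)"
  then have "i < m" by simp
  moreover have "i < dim_vec v"
    using assms(1) \<open>i < m\<close> by simp
  moreover have "v $ i \<le> 0"
    using assms(2) \<open>i < m\<close> unfolding less_eq_vec_def by (metis index_zero_vec)
  ultimately show "pos_part v $ i = 0\<^sub>v m $ i"
    by (simp add: pos_part_def)
next
  show "dim_vec (pos_part v) = dim_vec (0\<^sub>v m :: real vec)"
    using assms(1) by (simp add: pos_part_def)
qed

lemma eucl_norm_zero [simp]: "eucl_norm (0\<^sub>v m) = 0"
  by (simp add: eucl_norm_def L2_set_def)

lemma minus_carrier_vec_right: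
  fixes u v :: "real vec"
  assumes "v \<in> carrier_vec m"
  shows "u - v \<in> carrier_vec m"
  using assms by (intro carrier_vecI) simp

lemma residual_nonpos_iff:
  fixes A :: "real mat"
  assumes "A \<in> carrier_mat m n" "b \<in> carrier_vec m"
  shows "A *\<^sub>v x - b \<le> 0\<^sub>v m \<longleftrightarrow> A *\<^sub>v x \<le> b"
  using assms by (auto simp: less_eq_vec_def)

lemma scalar_prod_nonneg_nonpos:
  fixes l v :: "real vec"
  assumes l: "l \<in> nonneg_vecs m" and v: "v \<in> carrier_vec m" "v \<le> 0\<^sub>v m"
  shows "l \<bullet> v \<le> 0"
  unfolding scalar_prod_def
proof (rule sum_nonpos)
  fix i assume "i \<in> {0..<dim_vec v}"
  then have i: "i < m" using v(1) by simp
  have "dim_vec l = m" "0\<^sub>v m \<le> l"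
    using l unfolding nonneg_vecs_def carrier_vec_def by blast+
  then have "0 \<le> l $ i"
    using i unfolding less_eq_vec_def by (metis index_zero_vec(1))
  moreover have "v $ i \<le> 0"
    using v(2) i unfolding less_eq_vec_def by (metis index_zero_vec)
  ultimately show "l $ i * v $ i \<le> 0"
    by (rule mult_nonneg_nonpos)
qed

lemma aug_lagrangian_le_objective:
  assumes A: "A \<in> carrier_mat m n" and b: "b \<in> carrier_vec m"
    and l: "l \<in> nonneg_vecs m" and x: "A *\<^sub>v x \<le> b"
  shows "aug_lagrangian c A b x l \<rho> \<le> c \<bullet> x"
proof -
  have v: "A *\<^sub>v x - b \<in> carrier_vec m" "A *\<^sub>v x - b \<le> 0\<^sub>v m"
    using b x residual_nonpos_iff[OF A b] by (blast intro: minus_carrier_vec_right)+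
  show ?thesis
    using scalar_prod_nonneg_nonpos[OF l v] pos_part_eq_zero[OF v]
    by (simp add: aug_lagrangian_def)
qed

lemma alm_dual_value_le_ip_value:
  assumes A: "A \<in> carrier_mat m n" and b: "b \<in> carrier_vec m"
  shows "alm_dual_value X c A b \<rho> \<le> ip_value X c A b"
  unfolding alm_dual_value_def ip_value_def alm_relaxation_def
proof (intro SUP_least INF_greatest)
  fix l x assume "l \<in> nonneg_vecs (dim_vec b)" and x: "x \<in> ip_feasible_set X A b"
  then have "aug_lagrangian c A b x l \<rho> \<le> c \<bullet> x"
    using aug_lagrangian_le_objective[OF A b] b by (auto simp: ip_feasible_set_def)
  with x show "(INF x\<in>X. ereal (aug_lagrangian c A b x l \<rho>)) \<le> ereal (c \<bullet> x)"
    by (intro INF_lower2[of x]) (auto simp: ip_feasible_set_def)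
qed

lemma component_sq_le_eucl_norm_sq:
  assumes "i < dim_vec v"
  shows "(v $ i)\<^sup>2 \<le> (eucl_norm v)\<^sup>2"
  using assms unfolding eucl_norm_def L2_set_def
  by (simp add: sum_nonneg) (intro member_le_sum, auto)

text \<open>Infeasibility means that some single row is violated, and one violated row suffices:
  the remaining components can only enlarge the norm.\<close>

lemma penalty_ge_slack:
  assumes A: "A \<in> carrier_mat m n" and b: "b \<in> carrier_vec m"
    and x: "x \<in> X" "\<not> A *\<^sub>v x \<le> b"
    and slack: "\<And>i. i < m \<Longrightarrow> ereal \<delta> \<le> min_sq_slack X A b i"
  shows "\<delta> \<le> (eucl_norm (pos_part (A *\<^sub>v x - b)))\<^sup>2"
proof -
  obtain i where i: "i < m" and viol: "row A i \<bullet> x > b $ i"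
    using A b x(2) by (force simp: less_eq_vec_def not_le)
  have "min_sq_slack X A b i \<le> ereal ((row A i \<bullet> x - b $ i)\<^sup>2)"
    unfolding min_sq_slack_def using x(1) viol by (intro INF_lower) auto
  with slack[OF i] have "\<delta> \<le> (row A i \<bullet> x - b $ i)\<^sup>2"
    by (metis order_trans ereal_less_eq(3))
  also have "row A i \<bullet> x - b $ i = pos_part (A *\<^sub>v x - b) $ i"
    using A b i viol by (simp add: pos_part_def)
  also have "\<dots>\<^sup>2 \<le> (eucl_norm (pos_part (A *\<^sub>v x - b)))\<^sup>2"
    using A b i by (intro component_sq_le_eucl_norm_sq) (simp add: pos_part_def)
  finally show ?thesis .
qed

text \<open>A feasible point \<open>y\<close> is what turns the penalty on infeasible points into a bound by
  the optimal value, which is at most \<open>c \<bullet> y \<le> M\<close>.\<close>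

lemma ip_value_le_alm_relaxation_zero:
  assumes A: "A \<in> carrier_mat m n" and b: "b \<in> carrier_vec m"
    and feasible: "y \<in> ip_feasible_set X A b"
    and M: "\<And>x. x \<in> X \<Longrightarrow> \<bar>c \<bullet> x\<bar> \<le> M"
    and slack: "\<And>i. i < m \<Longrightarrow> ereal \<delta> \<le> min_sq_slack X A b i"
    and \<rho>: "0 \<le> \<rho>" "2 * M \<le> \<rho> / 2 * \<delta>"
  shows "ip_value X c A b \<le> alm_relaxation X c A b (0\<^sub>v m) \<rho>"
  unfolding alm_relaxation_def
proof (rule INF_greatest)
  fix x assume x: "x \<in> X"
  let ?N = "(eucl_norm (pos_part (A *\<^sub>v x - b)))\<^sup>2"
  have "A *\<^sub>v x - b \<in> carrier_vec m"
    using b by (rule minus_carrier_vec_right)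
  then have L: "aug_lagrangian c A b x (0\<^sub>v m) \<rho> = c \<bullet> x + \<rho> / 2 * ?N"
    by (simp add: aug_lagrangian_def)
  have "\<exists>z\<in>ip_feasible_set X A b. c \<bullet> z \<le> aug_lagrangian c A b x (0\<^sub>v m) \<rho>"
  proof (cases "A *\<^sub>v x \<le> b")
    case True
    moreover have "0 \<le> \<rho> / 2 * ?N"
      using \<rho>(1) by simp
    ultimately show ?thesis
      using x L by (intro bexI[of _ x]) (auto simp: ip_feasible_set_def)
  next
    case False
    have "\<rho> / 2 * \<delta> \<le> \<rho> / 2 * ?N"
      using penalty_ge_slack[OF A b x False slack] \<rho>(1) by (intro mult_left_mono) auto
    moreover have "c \<bullet> y \<le> M"
      using M[of y] feasible by (auto simp: ip_feasible_set_def)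
    ultimately show ?thesis
      using M[OF x] \<rho>(2) L feasible by (intro bexI[of _ y]) linarith+
  qed
  then show "ip_value X c A b \<le> ereal (aug_lagrangian c A b x (0\<^sub>v m) \<rho>)"
    unfolding ip_value_def by (meson INF_lower2 ereal_less_eq(3))
qed

theorem lemma2p1:
  fixes p m n :: nat and nn q :: "nat \<Rightarrow> nat"
    and c b :: "real vec" and A :: "real mat"
    and B :: "nat \<Rightarrow> real mat" and d :: "nat \<Rightarrow> real vec"
    and X :: "real vec set"
  assumes "p \<ge> 1"
    and "n = (\<Sum>j<p. nn j)"
    and "c \<in> carrier_vec n"
    and "A \<in> carrier_mat m n"
    and "b \<in> carrier_vec m"
    and "\<And>j. j < p \<Longrightarrow> B j \<in> carrier_mat (q j) (nn j)"
    and "\<And>j. j < p \<Longrightarrow> d j \<in> carrier_vec (q j)"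
    and "X = block_product_set p nn B d"
    and "X \<noteq> {}"
    and feasible: "ip_feasible_set X A b \<noteq> {}"
    and bounded: "\<bar>ip_value X c A b\<bar> \<noteq> \<infinity>"
    and slack: "\<exists>\<delta>::real. \<forall>i<m. 0 < \<delta> \<and> ereal \<delta> \<le> min_sq_slack X A b i"
  shows "\<exists>\<rho>::real. \<rho> > 0
    \<and> (\<exists>l\<in>nonneg_vecs m. alm_relaxation X c A b l \<rho> = alm_dual_value X c A b \<rho>)
    \<and> alm_dual_value X c A b \<rho> = ip_value X c A b"
proof -
  note A = \<open>A \<in> carrier_mat m n\<close> and b = \<open>b \<in> carrier_vec m\<close>
  \<comment> \<open>Without rows the slack hypothesis gives no positive number; any one does then.\<close>
  obtain \<delta> :: real where \<delta>: "\<delta> > 0" "\<And>i. i < m \<Longrightarrow> ereal \<delta> \<le> min_sq_slack X A b i"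
  proof (cases "m = 0")
    case True
    then show thesis using that[of 1] by simp
  next
    case False
    then show thesis using slack that by blast
  qed
  obtain y where y: "y \<in> ip_feasible_set X A b"
    using feasible by blast
  have "finite ((\<lambda>x. \<bar>c \<bullet> x\<bar>) ` X)"
    using \<open>X = block_product_set p nn B d\<close> finite_block_product_set by blast
  then obtain M0 where M0: "\<And>x. x \<in> X \<Longrightarrow> \<bar>c \<bullet> x\<bar> \<le> M0"
    by (meson bdd_above_finite bdd_above.E imageI)
  define M where "M = max M0 1"
  have M: "M > 0" "\<And>x. x \<in> X \<Longrightarrow> \<bar>c \<bullet> x\<bar> \<le> M"
    using M0 by (force simp: M_def)+
  \<comment> \<open>Makes \<open>\<rho> / 2 * \<delta>\<close> equal to \<open>2 * M\<close>, which bounds the difference of any two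
    objective values on \<open>X\<close>.\<close>
  define \<rho> where "\<rho> = 4 * M / \<delta>"
  have \<rho>: "\<rho> > 0" "2 * M \<le> \<rho> / 2 * \<delta>"
    using \<delta>(1) M(1) by (auto simp: \<rho>_def)
  have zero: "0\<^sub>v m \<in> nonneg_vecs m"
    unfolding nonneg_vecs_def by (intro CollectI conjI zero_carrier_vec order_refl)
  have "ip_value X c A b \<le> alm_relaxation X c A b (0\<^sub>v m) \<rho>"
    using \<rho> by (intro ip_value_le_alm_relaxation_zero[OF A b y M(2) \<delta>(2)]) auto
  moreover have "alm_relaxation X c A b (0\<^sub>v m) \<rho> \<le> alm_dual_value X c A b \<rho>"
    unfolding alm_dual_value_def using zero b by (intro SUP_upper) simp
  moreover have "alm_dual_value X c A b \<rho> \<le> ip_value X c A b"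
    by (rule alm_dual_value_le_ip_value[OF A b])
  ultimately have "alm_relaxation X c A b (0\<^sub>v m) \<rho> = alm_dual_value X c A b \<rho>"
    "alm_dual_value X c A b \<rho> = ip_value X c A b"
    by simp_all
  then show ?thesis
    using \<rho>(1) zero by blast
qed

end
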